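(* Consider the one-dimensional (linear or nonlinear) convection-diffusion equation $u_t+f(u)_x=\epsilon u_{xx}+g(x,t)$ on $[a,b]$, where $f$ is continuously differentiable and $\epsilon\ge 0$. Assume that the source term is $g(x,t)=0$ and that the boundary conditions are periodic. Let the equation be discretized by the 1D EL-RK-FV algorithm (described in the context) coupled with any IMEX Runge-Kutta scheme IMEX$(s,\sigma,p)$ of the Ascher-Ruuth-Spiteri type (described in the context). Then the algorithm is mass conservative: if $\overline u_j^{n}$ and $\overline u_j^{n+1}$ $(j=1,\dots,N_x)$ denote the cell averages at the beginning and at the end of a time step, then $$\Delta x\sum_{j=1}^{N_x}\overline u_j^{\,n+1}=\Delta x\sum_{j=1}^{N_x}\overline u_j^{\,n},$$ i.e. the total mass $\int_a^b u(x,t)\,dx$ of the numerical solution is the same at $t^{n+1}$ as at $t^n$.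
   Context: **Grid.** $[a,b]$ is divided into $N_x\ge 5$ uniform cells $I_j=[x_{j-1/2},x_{j+1/2}]$ of width $\Delta x=(b-a)/N_x$, with $x_{1/2}=a$, $x_{N_x+1/2}=b$. Everything is extended periodically: $x_{j+1/2}$ is defined for all $j\in\mathbb Z$, and cell quantities are $N_x$-periodic in $j$. One time step goes from $t^n$ to $t^{n+1}=t^n+\Delta t$, with $\Delta t>0$; the input is the vector of uniform cell averages $\overline u_j^n$. **Approximate characteristics.** Set $$\nu_{j+1/2}=\frac{f(\overline u^n_{j+1})-f(\overline u^n_j)}{\overline u^n_{j+1}-\overline u^n_j}\ \text{ if }\overline u^n_{j+1}\ne\overline u^n_j,\qquad \nu_{j+1/2}=f'(\overline u^n_j)\ \text{ otherwise.}$$ For a terminal time $\tau\in[t^n,t^{n+1}]$ and $t\in[t^n,t^{n+1}]$, the traceback nodes are $y^{\tau}_{j+1/2}(t)=x_{j+1/2}+\nu_{j+1/2}(t-\tau)$. The traceback cells are $\tilde I_j^{\tau}(t)=[y^\tau_{j-1/2}(t),y^\tau_{j+1/2}(t)]$. The time step is assumed to be such that all traceback cells used are genuine intervals, $y^\tau_{j-1/2}(t)<y^\tau_{j+1/2}(t)$. Taking $\tau=t^{n+1}$ gives the main space-time region $\Omega_j$. Taking $\tau=t^{(\mu)}$ (the $\mu$-th stage time below) gives the sub-space-time region ${}_\mu\Omega_j$, whose grid at time $t^{(\mu)}$ is the uniform grid. **WENO-AO(5,3) reconstruction.** Given periodic uniform cell averages $w=(w_j)$, the reconstruction polynomial on $I_j$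 is $$\mathcal R_j[w]=\frac{\omega_0}{\gamma_0}\Big(P_0-\sum_{k=1}^3\gamma_kP_k\Big)+\sum_{k=1}^3\omega_kP_k .$$ Here $P_0$ is the polynomial of degree $\le4$ whose cell averages on $I_{j-2},\dots,I_{j+2}$ are $w_{j-2},\dots,w_{j+2}$. For $k=1,2,3$, $P_k$ is the polynomial of degree $\le2$ whose cell averages match $w$ on the three cells $I_{j-3+k},I_{j-2+k},I_{j-1+k}$. The linear weights $\gamma_0,\dots,\gamma_3>0$ are fixed with $\sum_{k=0}^3\gamma_k=1$. The nonlinear weights are $\omega_k=\alpha_k/\sum_{l=0}^3\alpha_l$ with $\alpha_k=\gamma_k\big(1+\theta^2/(\beta_k+\delta_0)^2\big)$, where $\delta_0>0$ is a small constant, $\beta_k=\sum_{l\ge1}\int_{I_j}\Delta x^{2l-1}\big(P_k^{(l)}(x)\big)^2dx$, and $\theta=\frac13\sum_{k=1}^3|\beta_0-\beta_k|$. **Algorithm 1 (integral reconstruction).** Let $w$ be uniform cell averages, and let $y_{j+1/2}$ be traceback nodes with $y_{j-1/2}\in I_\ell$ and $y_{j+1/2}\in I_r$. The integral over the traceback cell $\tilde I_j=[y_{j-1/2},y_{j+1/2}]$ is computed as $$\Pi(w;y)_j=\int_{\tilde I_j\cap I_\ell}\mathcal R_\ell[w]\,dx+\Delta x\sum_{i=\ell+1}^{r-1}w_i+\int_{\tilde I_j\cap I_r}\mathcal R_r[w]\,dx\quad(\ell<r),\qquad \Pi(w;y)_j=\int_{\tilde I_j}\mathcal R_\ell[w]\,dx\quad(\ell=r).$$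 The polynomials $\mathcal R_i[w]$ are understood on the periodically extended grid. The nonuniform cell average is $\Pi(w;y)_j/(y_{j+1/2}-y_{j-1/2})$. **Algorithm 2 (point values).** Given nonuniform cell averages $\tilde u=(\tilde u_j)$ on a traceback grid, treat them as averages on the uniform grid and set $u^-_{j+1/2}=\mathcal R_j[\tilde u](x_{j+1/2})$ and $u^+_{j+1/2}=\mathcal R_{j+1}[\tilde u](x_{j+1/2})$. **Convective term.** Let $\hat F_{j+1/2}(u^-,u^+)$ be a monotone numerical flux (e.g. Lax-Friedrichs) consistent with the modified flux $v\mapsto f(v)-\nu_{j+1/2}v$. There is a single value per interface, and it is periodic in $j$. For uniform averages $w$ at time $t$ and a traceback grid $y$, define $$\mathcal F(w;y)_j=-\big[\hat F_{j+1/2}(u^-_{j+1/2},u^+_{j+1/2})-\hat F_{j-1/2}(u^-_{j-1/2},u^+_{j-1/2})\big],$$ where $u^\pm$ come from Algorithm 2 applied to the nonuniform averages obtained from $w$ and $y$ by Algorithm 1. **Diffusive term.** Let $\mathbf D_4$ be the periodic matrix $(\mathbf D_4w)_j=-\frac1{12}w_{j-2}+\frac43w_{j-1}-\frac52w_j+\frac43w_{j+1}-\frac1{12}w_{j+2}$. The uniform cell averages of $u_{xx}$ are $\overline u_{xx}=\Delta x^{-2}\mathbf D_4\overline u$. With $g=0$, define $\mathcal G(w;y)_j=\epsilon\,\Pi(\Delta x^{-2}\mathbf D_4w;\,y)_j$. **IMEX$(s,\sigma,p)$ scheme.** This is a pair of Butcher tableaux of combined order $p\ge1$, as in Ascher,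 Ruuth and Spiteri (1997). It consists of an $s$-stage diagonally implicit scheme with coefficients $a_{\mu\kappa}$ ($1\le\kappa\le\mu\le s$, $a_{\mu\mu}>0$), weights $b_\mu$ and abscissae $c_\mu\in[0,1]$, and a $\sigma$-stage explicit scheme, $\sigma\in\{s,s+1\}$, with coefficients $\hat a_{\mu+1,\kappa}$ ($1\le\kappa\le\mu\le s$), abscissae $0,c_1,\dots,c_s$, and weights $\hat b_1,\dots,\hat b_\sigma$. Set $t^{(\mu)}=t^n+c_\mu\Delta t$. **The 1D EL-RK-FV algorithm (one time step, $g=0$).** For $\mu=1,\dots,s$, compute uniform stage averages $\overline u^{(\mu)}$ by solving the linear system $$\Big(\mathbf I-\frac{a_{\mu\mu}\epsilon\Delta t}{\Delta x^2}\mathbf D_4\Big)\,{}_\mu U^{(\mu)}={}_\mu U^n+\Delta t\sum_{\kappa=1}^{\mu-1}a_{\mu\kappa}\,{}_\mu K_\kappa+\Delta t\sum_{\kappa=1}^{\mu}\hat a_{\mu+1,\kappa}\,{}_\mu\hat K_\kappa,\qquad \overline u^{(\mu)}_j={}_\mu U^{(\mu)}_j/\Delta x.$$ All left-subscripted quantities are computed on the sub-region with terminal time $\tau=t^{(\mu)}$: - ${}_\mu U^n=\Pi(\overline u^n;y^{\tau}(t^n))$, - ${}_\mu\hat K_1=\mathcal F(\overline u^n;y^\tau(t^n))$, - ${}_\mu K_\kappa=\mathcal G(\overline u^{(\kappa)};y^\tau(t^{(\kappa)}))$ and ${}_\mu\hat K_{\kappa+1}=\mathcal F(\overline u^{(\kappa)};y^\tau(t^{(\kappa)}))$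 for $1\le\kappa\le\mu-1$. Then, on the main region with $\tau=t^{n+1}$, set $U^n=\Pi(\overline u^n;y^\tau(t^n))$, $\hat K_1=\mathcal F(\overline u^n;y^\tau(t^n))$, and, for $\mu=1,\dots,s$, $K_\mu=\mathcal G(\overline u^{(\mu)};y^\tau(t^{(\mu)}))$ and $\hat K_{\mu+1}=\mathcal F(\overline u^{(\mu)};y^\tau(t^{(\mu)}))$. The update is $$U^{n+1}=U^n+\Delta t\sum_{\mu=1}^s b_\mu K_\mu+\Delta t\sum_{\mu=1}^{\sigma}\hat b_\mu\hat K_\mu,\qquad \overline u^{n+1}_j=U^{n+1}_j/\Delta x .$$ *)

theory Defs
  imports "HOL-Analysis.Analysis" "HOL-Computational_Algebra.Polynomial"
begin

section \<open>IMEX Runge--Kutta tableaux of Ascher--Ruuth--Spiteri type\<close>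

text \<open>
  All tableau indices start at 1, as in the literature. The implicit part has the entries
  \<open>impl_a \<mu> \<kappa>\<close> for \<open>1 \<le> \<kappa> \<le> \<mu> \<le> s\<close>; the explicit part has the entries
  \<open>expl_a (\<mu> + 1) \<kappa>\<close> for \<open>1 \<le> \<kappa> \<le> \<mu> \<le> s\<close> and the abscissae
  \<open>0, c\<^sub>1, \<dots>, c\<^sub>s\<close>. Entries outside these ranges are never used.
\<close>

record imex_tableau =
  n_impl :: nat
  n_expl :: nat
  impl_a :: "nat \<Rightarrow> nat \<Rightarrow> real"
  impl_b :: "nat \<Rightarrow> real"
  absc :: "nat \<Rightarrow> real"
  expl_a :: "nat \<Rightarrow> nat \<Rightarrow> real"
  expl_b :: "nat \<Rightarrow> real"

text \<open>
  Combined order is expressed by the order conditions of additive Runge--Kutta methods, indexed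
  by rooted trees whose nodes are coloured according to the part of the right-hand side
  (implicit or explicit) they stand for. For this purpose both tableaux are written on the common
  stages \<open>0, \<dots>, s\<close>: stage 0 is the initial value, the implicit tableau is padded by a zero row and
  a zero column, and stage \<open>i\<close> is the explicit stage number \<open>i + 1\<close>.
\<close>

datatype colour = Impl | Expl

datatype ctree = Node colour "ctree list"

fun padded_a :: "imex_tableau \<Rightarrow> colour \<Rightarrow> nat \<Rightarrow> nat \<Rightarrow> real" where
  "padded_a M Impl i j = (if 1 \<le> j \<and> j \<le> i then impl_a M i j else 0)"
| "padded_a M Expl i j = (if j < i then expl_a M (i + 1) (j + 1) else 0)"

fun padded_b :: "imex_tableau \<Rightarrow> colour \<Rightarrow> nat \<Rightarrow> real" where
  "padded_b M Impl j = (if 1 \<le> j then impl_b M j else 0)"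
| "padded_b M Expl j = (if j + 1 \<le> n_expl M then expl_b M (j + 1) else 0)"

fun tree_order :: "ctree \<Rightarrow> nat" where
  "tree_order (Node q ts) = 1 + sum_list (map tree_order ts)"

fun tree_density :: "ctree \<Rightarrow> nat" where
  "tree_density (Node q ts) = tree_order (Node q ts) * prod_list (map tree_density ts)"

fun stage_weight :: "imex_tableau \<Rightarrow> nat \<Rightarrow> ctree \<Rightarrow> real" where
  "stage_weight M i (Node q ts) =
     (\<Sum>j=0..n_impl M. padded_a M q i j * prod_list (map (stage_weight M j) ts))"

fun elementary_weight :: "imex_tableau \<Rightarrow> ctree \<Rightarrow> real" where
  "elementary_weight M (Node q ts) =
     (\<Sum>j=0..n_impl M. padded_b M q j * prod_list (map (stage_weight M j) ts))"

definition combined_order :: "imex_tableau \<Rightarrow> nat \<Rightarrow> bool" where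
  "combined_order M p \<longleftrightarrow>
     (\<forall>t. tree_order t \<le> p \<longrightarrow> elementary_weight M t = 1 / real (tree_density t))"

definition imex_scheme :: "imex_tableau \<Rightarrow> nat \<Rightarrow> nat \<Rightarrow> nat \<Rightarrow> bool" where
  "imex_scheme M s \<sigma> p \<longleftrightarrow>
     n_impl M = s \<and> n_expl M = \<sigma> \<and> s \<ge> 1 \<and> (\<sigma> = s \<or> \<sigma> = s + 1) \<and>
     (\<forall>\<mu>\<in>{1..s}. impl_a M \<mu> \<mu> > 0 \<and> 0 \<le> absc M \<mu> \<and> absc M \<mu> \<le> 1) \<and>
     p \<ge> 1 \<and> combined_order M p"

section \<open>The discretization\<close>

record el_scheme =
  left_end :: real
  right_end :: real
  n_cells :: nat
  flux :: "real \<Rightarrow> real"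
  diffusion :: real
  lin_weight :: "nat \<Rightarrow> real"
  small_const :: real
  num_flux :: "int \<Rightarrow> real \<Rightarrow> real \<Rightarrow> real"
  tableau :: imex_tableau
  time_n :: real
  time_step :: real

definition periodic :: "nat \<Rightarrow> (int \<Rightarrow> 'a) \<Rightarrow> bool" where
  "periodic N w \<longleftrightarrow> (\<forall>j. w (j + int N) = w j)"

text \<open>
  Cell quantities and interface quantities are both indexed by all integers. Interface number
  \<open>j\<close> is the one with the half-integer index \<open>j + 1/2\<close>.
\<close>

definition mesh_width :: "el_scheme \<Rightarrow> real" where
  "mesh_width E = (right_end E - left_end E) / real (n_cells E)"

definition node :: "el_scheme \<Rightarrow> int \<Rightarrow> real" where
  "node E j = left_end E + of_int j * mesh_width E"

definition cell :: "el_scheme \<Rightarrow> int \<Rightarrow> real set" where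
  "cell E j = {node E (j - 1)..node E j}"

subsection \<open>WENO-AO(5,3) reconstruction\<close>

definition cell_avg :: "el_scheme \<Rightarrow> real poly \<Rightarrow> int \<Rightarrow> real" where
  "cell_avg E p i = integral (cell E i) (poly p) / mesh_width E"

definition stencil_poly :: "el_scheme \<Rightarrow> (int \<Rightarrow> real) \<Rightarrow> nat \<Rightarrow> int set \<Rightarrow> real poly" where
  "stencil_poly E w d S = (THE p. degree p \<le> d \<and> (\<forall>i\<in>S. cell_avg E p i = w i))"

definition weno_poly :: "el_scheme \<Rightarrow> (int \<Rightarrow> real) \<Rightarrow> int \<Rightarrow> nat \<Rightarrow> real poly" where
  "weno_poly E w j k =
     (if k = 0 then stencil_poly E w 4 {j - 2..j + 2}
      else stencil_poly E w 2 {j - 3 + int k..j - 1 + int k})"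

text \<open>The sum over all derivatives stops at the degree, beyond which they vanish.\<close>

definition smoothness :: "el_scheme \<Rightarrow> (int \<Rightarrow> real) \<Rightarrow> int \<Rightarrow> nat \<Rightarrow> real" where
  "smoothness E w j k =
     (\<Sum>l=1..degree (weno_poly E w j k).
        integral (cell E j)
          (\<lambda>x. mesh_width E ^ (2 * l - 1) * (poly ((pderiv ^^ l) (weno_poly E w j k)) x)\<^sup>2))"

definition weno_theta :: "el_scheme \<Rightarrow> (int \<Rightarrow> real) \<Rightarrow> int \<Rightarrow> real" where
  "weno_theta E w j = (\<Sum>k=1..3. \<bar>smoothness E w j 0 - smoothness E w j k\<bar>) / 3"

definition weno_alpha :: "el_scheme \<Rightarrow> (int \<Rightarrow> real) \<Rightarrow> int \<Rightarrow> nat \<Rightarrow> real" where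
  "weno_alpha E w j k =
     lin_weight E k * (1 + (weno_theta E w j)\<^sup>2 / (smoothness E w j k + small_const E)\<^sup>2)"

definition weno_omega :: "el_scheme \<Rightarrow> (int \<Rightarrow> real) \<Rightarrow> int \<Rightarrow> nat \<Rightarrow> real" where
  "weno_omega E w j k = weno_alpha E w j k / (\<Sum>l=0..3. weno_alpha E w j l)"

definition weno_rec :: "el_scheme \<Rightarrow> (int \<Rightarrow> real) \<Rightarrow> int \<Rightarrow> real poly" where
  "weno_rec E w j =
     smult (weno_omega E w j 0 / lin_weight E 0)
       (weno_poly E w j 0 - (\<Sum>k=1..3. smult (lin_weight E k) (weno_poly E w j k)))
     + (\<Sum>k=1..3. smult (weno_omega E w j k) (weno_poly E w j k))"

subsection \<open>Traceback grids\<close>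

definition char_speed :: "el_scheme \<Rightarrow> (int \<Rightarrow> real) \<Rightarrow> int \<Rightarrow> real" where
  "char_speed E u j =
     (if u (j + 1) \<noteq> u j
      then (flux E (u (j + 1)) - flux E (u j)) / (u (j + 1) - u j)
      else deriv (flux E) (u j))"

text \<open>Here \<open>u\<close> is the vector of cell averages at the beginning of the time step, \<open>\<tau>\<close> the terminal time.\<close>

definition traceback :: "el_scheme \<Rightarrow> (int \<Rightarrow> real) \<Rightarrow> real \<Rightarrow> real \<Rightarrow> int \<Rightarrow> real" where
  "traceback E u \<tau> t j = node E j + char_speed E u j * (t - \<tau>)"

subsection \<open>Integral reconstruction and point values\<close>

text \<open>
  A node lying on the interface of two cells is assigned to the right one. Since the
  reconstruction polynomial of a cell has the prescribed average on this cell, assigning it to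
  the left one would lead to the same integrals.
\<close>

definition cell_index :: "el_scheme \<Rightarrow> real \<Rightarrow> int" where
  "cell_index E x = \<lfloor>(x - left_end E) / mesh_width E\<rfloor> + 1"

definition cell_integral :: "el_scheme \<Rightarrow> (int \<Rightarrow> real) \<Rightarrow> (int \<Rightarrow> real) \<Rightarrow> int \<Rightarrow> real" where
  "cell_integral E w y j =
     (let l = cell_index E (y (j - 1)); r = cell_index E (y j); T = {y (j - 1)..y j} in
      if l < r then
        integral (T \<inter> cell E l) (poly (weno_rec E w l))
        + mesh_width E * (\<Sum>i=l+1..r-1. w i)
        + integral (T \<inter> cell E r) (poly (weno_rec E w r))
      else integral T (poly (weno_rec E w l)))"

definition nonuniform_avg :: "el_scheme \<Rightarrow> (int \<Rightarrow> real) \<Rightarrow> (int \<Rightarrow> real) \<Rightarrow> int \<Rightarrow> real" where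
  "nonuniform_avg E w y j = cell_integral E w y j / (y j - y (j - 1))"

definition u_minus :: "el_scheme \<Rightarrow> (int \<Rightarrow> real) \<Rightarrow> (int \<Rightarrow> real) \<Rightarrow> int \<Rightarrow> real" where
  "u_minus E w y j = poly (weno_rec E (nonuniform_avg E w y) j) (node E j)"

definition u_plus :: "el_scheme \<Rightarrow> (int \<Rightarrow> real) \<Rightarrow> (int \<Rightarrow> real) \<Rightarrow> int \<Rightarrow> real" where
  "u_plus E w y j = poly (weno_rec E (nonuniform_avg E w y) (j + 1)) (node E j)"

subsection \<open>Convective and diffusive terms\<close>

definition monotone_flux_on :: "real set \<Rightarrow> (real \<Rightarrow> real \<Rightarrow> real) \<Rightarrow> bool" where
  "monotone_flux_on D F \<longleftrightarrow>
     (\<forall>v\<in>D. mono_on D (\<lambda>u. F u v)) \<and> (\<forall>u\<in>D. antimono_on D (\<lambda>v. F u v))"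

definition interface_flux :: "el_scheme \<Rightarrow> (int \<Rightarrow> real) \<Rightarrow> (int \<Rightarrow> real) \<Rightarrow> int \<Rightarrow> real" where
  "interface_flux E w y j = num_flux E j (u_minus E w y j) (u_plus E w y j)"

definition convective :: "el_scheme \<Rightarrow> (int \<Rightarrow> real) \<Rightarrow> (int \<Rightarrow> real) \<Rightarrow> int \<Rightarrow> real" where
  "convective E w y j = - (interface_flux E w y j - interface_flux E w y (j - 1))"

definition D4 :: "(int \<Rightarrow> real) \<Rightarrow> int \<Rightarrow> real" where
  "D4 w j = - (1/12) * w (j - 2) + (4/3) * w (j - 1) - (5/2) * w j
            + (4/3) * w (j + 1) - (1/12) * w (j + 2)"

definition diffusive :: "el_scheme \<Rightarrow> (int \<Rightarrow> real) \<Rightarrow> (int \<Rightarrow> real) \<Rightarrow> int \<Rightarrow> real" where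
  "diffusive E w y j =
     diffusion E * cell_integral E (\<lambda>i. D4 w i / (mesh_width E)\<^sup>2) y j"

subsection \<open>One time step\<close>

text \<open>
  The uniform cell averages of all stages are collected in one family \<open>U\<close>: \<open>U 0\<close> are the averages
  at the beginning of the step, and \<open>U \<mu>\<close> those of stage \<open>\<mu>\<close>. Correspondingly, \<open>stage_time E 0\<close> is
  the time at the beginning of the step, whatever the value \<open>absc (tableau E) 0\<close> is.
\<close>

definition stage_time :: "el_scheme \<Rightarrow> nat \<Rightarrow> real" where
  "stage_time E \<mu> =
     (if \<mu> = 0 then time_n E else time_n E + absc (tableau E) \<mu> * time_step E)"

definition end_time :: "el_scheme \<Rightarrow> real" where
  "end_time E = time_n E + time_step E"

definition stage_grid :: "el_scheme \<Rightarrow> (nat \<Rightarrow> int \<Rightarrow> real) \<Rightarrow> real \<Rightarrow> nat \<Rightarrow> int \<Rightarrow> real" where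
  "stage_grid E U \<tau> \<kappa> = traceback E (U 0) \<tau> (stage_time E \<kappa>)"

definition mass_n :: "el_scheme \<Rightarrow> (nat \<Rightarrow> int \<Rightarrow> real) \<Rightarrow> real \<Rightarrow> int \<Rightarrow> real" where
  "mass_n E U \<tau> = cell_integral E (U 0) (stage_grid E U \<tau> 0)"

definition K_impl :: "el_scheme \<Rightarrow> (nat \<Rightarrow> int \<Rightarrow> real) \<Rightarrow> real \<Rightarrow> nat \<Rightarrow> int \<Rightarrow> real" where
  "K_impl E U \<tau> \<kappa> = diffusive E (U \<kappa>) (stage_grid E U \<tau> \<kappa>)"

text \<open>The explicit slope number \<open>\<kappa>\<close> belongs to stage \<open>\<kappa> - 1\<close>; it is used for \<open>\<kappa> \<ge> 1\<close> only.\<close>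

definition K_expl :: "el_scheme \<Rightarrow> (nat \<Rightarrow> int \<Rightarrow> real) \<Rightarrow> real \<Rightarrow> nat \<Rightarrow> int \<Rightarrow> real" where
  "K_expl E U \<tau> \<kappa> = convective E (U (\<kappa> - 1)) (stage_grid E U \<tau> (\<kappa> - 1))"

definition stage_system :: "el_scheme \<Rightarrow> (nat \<Rightarrow> int \<Rightarrow> real) \<Rightarrow> nat \<Rightarrow> bool" where
  "stage_system E U \<mu> \<longleftrightarrow>
     (\<exists>V. periodic (n_cells E) V \<and>
        (\<forall>j. V j - impl_a (tableau E) \<mu> \<mu> * diffusion E * time_step E / (mesh_width E)\<^sup>2 * D4 V j
             = mass_n E U (stage_time E \<mu>) j
               + time_step E *
                   (\<Sum>\<kappa>\<in>{1..<\<mu>}. impl_a (tableau E) \<mu> \<kappa> * K_impl E U (stage_time E \<mu>) \<kappa> j)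
               + time_step E *
                   (\<Sum>\<kappa>\<in>{1..\<mu>}. expl_a (tableau E) (\<mu> + 1) \<kappa> * K_expl E U (stage_time E \<mu>) \<kappa> j)) \<and>
        (\<forall>j. U \<mu> j = V j / mesh_width E))"

definition mass_next :: "el_scheme \<Rightarrow> (nat \<Rightarrow> int \<Rightarrow> real) \<Rightarrow> int \<Rightarrow> real" where
  "mass_next E U j =
     mass_n E U (end_time E) j
     + time_step E *
         (\<Sum>\<mu>\<in>{1..n_impl (tableau E)}. impl_b (tableau E) \<mu> * K_impl E U (end_time E) \<mu> j)
     + time_step E *
         (\<Sum>\<mu>\<in>{1..n_expl (tableau E)}. expl_b (tableau E) \<mu> * K_expl E U (end_time E) \<mu> j)"

text \<open>
  The algorithm takes the averages \<open>u\<close> to the averages \<open>u'\<close>, with \<open>U\<close> as stage averages.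
\<close>

definition el_rk_fv_step ::
    "el_scheme \<Rightarrow> (nat \<Rightarrow> int \<Rightarrow> real) \<Rightarrow> (int \<Rightarrow> real) \<Rightarrow> (int \<Rightarrow> real) \<Rightarrow> bool" where
  "el_rk_fv_step E U u u' \<longleftrightarrow>
     U 0 = u \<and>
     (\<forall>\<mu>\<in>{1..n_impl (tableau E)}. stage_system E U \<mu>) \<and>
     (\<forall>j. u' j = mass_next E U j / mesh_width E)"

text \<open>
  The pairs (terminal time, stage) at which the algorithm evaluates traceback grids:
  those of the sub-regions and those of the main region.
\<close>

definition used_grids :: "el_scheme \<Rightarrow> (real \<times> nat) set" where
  "used_grids E =
     {(stage_time E \<mu>, \<kappa>) | \<mu> \<kappa>. \<mu> \<in> {1..n_impl (tableau E)} \<and> \<kappa> < \<mu>}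
     \<union> {(end_time E, \<kappa>) | \<kappa>. \<kappa> \<le> n_impl (tableau E)}"

definition genuine_grid :: "(int \<Rightarrow> real) \<Rightarrow> bool" where
  "genuine_grid y \<longleftrightarrow> (\<forall>j. y (j - 1) < y j)"

end

theory Submission
  imports Defs
begin

text \<open>
  Every term of the update is a difference of interface quantities. For the convective terms this is
  the definition, with a flux that is periodic since the reconstruction of periodic data commutes
  with a translation by one period (\<open>weno_rec_shift\<close>); so these terms add up to 0 over a period.

  The integrals over the traceback cells are differences too. Let \<open>M x\<close> be the mass of the piecewise
  polynomial reconstruction between the left end of the interval and \<open>x\<close> (\<open>cumulative_mass\<close>). The
  reconstruction polynomial of a cell has the prescribed average on this cell
  (\<open>cell_avg_weno_rec\<close>), and therefore the integral over the traceback cell number \<open>j\<close> is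
  \<open>M (y j) - M (y (j - 1))\<close> for every way in which the traceback cell lies across the uniform
  cells. Moving \<open>x\<close> by one period increases \<open>M x\<close> by the total mass. The characteristic speeds are
  periodic, so the traceback node \<open>y N\<close> is \<open>y 0\<close> moved by one period, where \<open>N\<close> is the number
  of cells, and the integrals over the \<open>N\<close> traceback cells add up to the total mass of the data
  that are integrated.

  Applied to the averages at the beginning of the step, this yields the old mass. Applied to the
  averages of the second derivative, it yields a multiple of the sum of \<open>D4 w j\<close> over \<open>j\<close>, which is 0
  as the stencil is itself in flux form (\<open>sum_D4\<close>). The stage equations enter through the
  periodicity of the stage averages.

  The reconstruction has the required properties because a polynomial of degree \<open>\<le> d\<close> is determined
  by its averages on \<open>d + 1\<close> consecutive cells, which may be prescribed at will: averages are
  increments of an antiderivative at the nodes, so this is interpolation by polynomials of degree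
  \<open>\<le> d + 1\<close> at \<open>d + 2\<close> nodes, up to constants.
\<close>

section \<open>Sums over the cells of one period\<close>

lemma periodic_shift: "periodic N w \<Longrightarrow> w (j + int N) = w j"
  by (simp add: periodic_def)

lemma periodic_shift_neighbour:
  assumes "periodic N w"
  shows "w (j + int N + k) = w (j + k)" and "w (j + int N - k) = w (j - k)"
  using periodic_shift[OF assms, of "j + k"] periodic_shift[OF assms, of "j - k"]
  by (simp_all add: algebra_simps)

lemma sum_int_telescope:
  fixes G :: "int \<Rightarrow> 'a::ab_group_add"
  shows "(\<Sum>j=1..int n. G j - G (j - 1)) = G (int n) - G 0"
proof (induction n)
  case (Suc n)
  have "{1..int (Suc n)} = insert (int (Suc n)) {1..int n}" by auto
  then show ?case using Suc by simp
qed simp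

lemma sum_flux_difference:
  fixes G :: "int \<Rightarrow> real"
  assumes "periodic N G"
  shows "(\<Sum>j=1..int N. G j - G (j - 1)) = 0"
  using sum_int_telescope[of G N] periodic_shift[OF assms, of 0] by simp

text \<open>
  The fourth-order stencil is in flux form: it is the difference of the interface quantities
  below, which discretize \<open>\<Delta>x u\<^sub>x\<close>.
\<close>

lemma sum_D4:
  assumes "periodic N w"
  shows "(\<Sum>j=1..int N. D4 w j) = 0"
proof -
  define G where "G j = (1/12) * w (j - 1) - (5/4) * w j + (5/4) * w (j + 1) - (1/12) * w (j + 2)"
    for j
  have "D4 w j = G j - G (j - 1)" for j
    by (simp add: D4_def G_def algebra_simps)
  moreover have "periodic N G"
    unfolding periodic_def G_def
    by (simp add: periodic_shift[OF assms] periodic_shift_neighbour[OF assms])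
  ultimately show ?thesis using sum_flux_difference by simp
qed

lemma periodic_D4: "periodic N w \<Longrightarrow> periodic N (D4 w)"
  unfolding periodic_def[of N "D4 w"] D4_def
  by (simp add: periodic_shift periodic_shift_neighbour)

text \<open>
  A function on all integers whose backward difference is \<open>w\<close>. One of the two sums is always
  empty, so that no case distinction on the sign is needed.
\<close>

definition discrete_primitive :: "(int \<Rightarrow> real) \<Rightarrow> int \<Rightarrow> real" where
  "discrete_primitive w j = (\<Sum>i=1..j. w i) - (\<Sum>i=j+1..0. w i)"

lemma discrete_primitive_diff: "discrete_primitive w j - discrete_primitive w (j - 1) = w j"
proof (cases "1 \<le> j")
  case True
  then have "{1..j} = insert j {1..j - 1}" by auto
  then show ?thesis using True by (simp add: discrete_primitive_def)
next
  case False
  then have "{j..0} = insert j {j + 1..0}" by auto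
  then show ?thesis using False by (simp add: discrete_primitive_def)
qed

lemma discrete_primitive_sum:
  assumes "l \<le> r"
  shows "(\<Sum>i=l+1..r. w i) = discrete_primitive w r - discrete_primitive w l"
  using assms
proof (induction r rule: int_ge_induct)
  case (step i)
  have "{l + 1..i + 1} = insert (i + 1) {l + 1..i}" using step.hyps by auto
  then show ?case using step.IH discrete_primitive_diff[of w "i + 1"] by simp
qed simp

lemma discrete_primitive_shift:
  assumes "periodic N w"
  shows "discrete_primitive w (j + int N) = discrete_primitive w j + (\<Sum>i=1..int N. w i)"
proof -
  define D where "D j = discrete_primitive w (j + int N) - discrete_primitive w j" for j
  have D_step: "D i = D (i - 1)" for i
    using discrete_primitive_diff[of w i] discrete_primitive_diff[of w "i + int N"]
      periodic_shift[OF assms, of i]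
    by (simp add: D_def algebra_simps)
  have "D j = D 0"
  proof (induction j rule: int_induct[where k = 0])
    case (step1 i)
    then show ?case using D_step[of "i + 1"] by simp
  next
    case (step2 i)
    then show ?case using D_step[of i] by simp
  qed simp
  then show ?thesis by (simp add: D_def discrete_primitive_def)
qed

section \<open>Polynomials with prescribed cell averages\<close>

lemma integrable_poly: "poly (p :: real poly) integrable_on {a..b}"
  by (intro integrable_continuous_interval continuous_intros)

lemma integral_poly_pderiv:
  fixes q :: "real poly"
  assumes "a \<le> b"
  shows "integral {a..b} (poly (pderiv q)) = poly q b - poly q a"
proof (rule integral_unique, rule fundamental_theorem_of_calculus[OF assms])
  fix x
  show "(poly q has_vector_derivative poly (pderiv q) x) (at x within {a..b})"
    using poly_DERIV[of q x]
    by (auto simp: has_real_derivative_iff_has_vector_derivative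
        intro: has_vector_derivative_at_within)
qed

lemma poly_antiderivative_exists:
  fixes p :: "real poly"
  obtains q where "pderiv q = p"
proof
  show "pderiv (\<Sum>i\<le>degree p. monom (coeff p i / real (Suc i)) (Suc i)) = p"
  proof -
    have "pderiv (\<Sum>i\<in>A. monom (coeff p i / real (Suc i)) (Suc i)) = (\<Sum>i\<in>A. monom (coeff p i) i)"
      for A
      by (simp add: higher_pderiv_sum[of 1, simplified] pderiv_monom)
    then show ?thesis by (simp add: poly_as_sum_of_monoms)
  qed
qed

lemma cell_avg_add: "cell_avg E (p + q) i = cell_avg E p i + cell_avg E q i"
proof -
  have "poly (p + q) = (\<lambda>x. poly p x + poly q x)" by (auto simp: fun_eq_iff)
  then show ?thesis
    by (simp add: cell_avg_def cell_def integrable_poly integral_add add_divide_distrib)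
qed

lemma cell_avg_smult: "cell_avg E (smult c p) i = c * cell_avg E p i"
proof -
  have "poly (smult c p) = (\<lambda>x. c * poly p x)" by (auto simp: fun_eq_iff)
  then show ?thesis by (simp add: cell_avg_def)
qed

lemma cell_avg_diff: "cell_avg E (p - q) i = cell_avg E p i - cell_avg E q i"
  using cell_avg_add[of E "p - q" q i] by simp

lemma cell_avg_sum: "cell_avg E (\<Sum>k\<in>A. p k) i = (\<Sum>k\<in>A. cell_avg E (p k) i)"
proof (induction A rule: infinite_finite_induct)
  case (insert k A)
  then show ?case by (simp add: cell_avg_add)
qed (simp_all add: cell_avg_smult[of E 0 0, simplified])

lemma node_le: "0 < mesh_width E \<Longrightarrow> i \<le> j \<Longrightarrow> node E i \<le> node E j"
  by (simp add: node_def mult_right_mono)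

lemma inj_node: "0 < mesh_width E \<Longrightarrow> inj (node E)"
  by (auto simp: inj_def node_def)

lemma cell_avg_pderiv:
  assumes "0 < mesh_width E"
  shows "cell_avg E (pderiv q) i = (poly q (node E i) - poly q (node E (i - 1))) / mesh_width E"
  using integral_poly_pderiv[OF node_le[OF assms, of "i - 1" i]]
  by (simp add: cell_avg_def cell_def)

text \<open>
  An antiderivative of a polynomial with vanishing averages takes the same value at all \<open>d + 2\<close>
  nodes of the \<open>d + 1\<close> cells, which is too often for a nonconstant polynomial of degree
  \<open>\<le> d + 1\<close>.
\<close>

lemma poly_zero_if_averages_zero:
  assumes h: "0 < mesh_width E" and deg: "degree p \<le> d"
    and avg: "\<And>i. i \<in> {a..a + int d} \<Longrightarrow> cell_avg E p i = 0"
  shows "p = 0"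
proof -
  obtain q where q: "pderiv q = p" by (rule poly_antiderivative_exists)
  have step: "poly q (node E i) = poly q (node E (i - 1))" if "i \<in> {a..a + int d}" for i
    using avg[OF that] cell_avg_pderiv[OF h, of q i] h q by simp
  have const: "poly q (node E (a - 1 + int n)) = poly q (node E (a - 1))" if "n \<le> Suc d" for n
    using that
  proof (induction n)
    case (Suc n)
    then show ?case using step[of "a + int n"] by (simp add: algebra_simps)
  qed simp
  have "q = [:poly q (node E (a - 1)):]"
  proof (rule poly_eqI_degree)
    let ?A = "node E ` (\<lambda>n. a - 1 + int n) ` {..Suc d}"
    have "card ?A = d + 2"
      using inj_node[OF h] by (subst card_image, auto intro: inj_on_subset simp: card_image inj_on_def)
    moreover have "degree q \<le> d + 1" using deg degree_pderiv[of q] q by simp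
    ultimately show "degree q < card ?A" "degree [:poly q (node E (a - 1)):] < card ?A" by simp_all
    show "poly q x = poly [:poly q (node E (a - 1)):] x" if "x \<in> ?A" for x
      using that const by auto
  qed
  then show ?thesis using q by (metis pderiv_singleton)
qed

text \<open>
  As in Newton interpolation, cells are added one by one. The polynomial correcting the average on
  the new cell without disturbing the others is the derivative of the product of \<open>x - x\<^sub>n\<close> over all
  nodes \<open>x\<^sub>n\<close> of the old cells: this product takes the value 0 at these nodes, but not at the new one.
\<close>

lemma poly_with_averages_exists:
  assumes h: "0 < mesh_width E"
  shows "\<exists>p. degree p \<le> d \<and> (\<forall>i\<in>{a..a + int d}. cell_avg E p i = w i)"
proof -
  have extend: "\<exists>p'. degree p' \<le> n \<and> (\<forall>i\<in>{a..a + int n}. cell_avg E p' i = w i)"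
    if deg: "degree p \<le> n" and avg: "\<forall>i\<in>{a..<a + int n}. cell_avg E p i = w i" for p n
  proof -
    define q where "q = (\<Prod>i\<in>{a - 1..<a + int n}. [:- node E i, 1:])"
    define m where "m = a + int n"
    have "degree q \<le> Suc n"
      using degree_prod_sum_le[of "{a - 1..<a + int n}" "\<lambda>i. [:- node E i, 1:]"]
      by (simp add: q_def)
    then have q_deg: "degree (pderiv q) \<le> n" by (simp add: degree_pderiv)
    have q_root: "poly q (node E i) = 0" if "i \<in> {a - 1..<a + int n}" for i
      using that by (auto simp: q_def poly_prod)
    have "poly q (node E m) \<noteq> 0"
      by (auto simp: q_def m_def poly_prod dest: injD[OF inj_node[OF h]])
    then have new: "cell_avg E (pderiv q) m \<noteq> 0"
      using q_root[of "m - 1"] h by (simp add: cell_avg_pderiv[OF h] m_def)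
    have old: "cell_avg E (pderiv q) i = 0" if "i \<in> {a..<a + int n}" for i
      using that q_root by (simp add: cell_avg_pderiv[OF h])
    define c where "c = (w m - cell_avg E p m) / cell_avg E (pderiv q) m"
    have "degree (p + smult c (pderiv q)) \<le> n"
      using deg q_deg by (intro degree_add_le) (auto intro: order.trans[OF degree_smult_le])
    moreover have "cell_avg E (p + smult c (pderiv q)) i = w i" if "i \<in> {a..a + int n}" for i
    proof (cases "i = m")
      case True
      then show ?thesis using new by (simp add: cell_avg_add cell_avg_smult c_def)
    next
      case False
      then have "i \<in> {a..<a + int n}" using that by (auto simp: m_def)
      then show ?thesis using avg old by (simp add: cell_avg_add cell_avg_smult)
    qed
    ultimately show ?thesis by blast
  qed
  show ?thesis
  proof (induction d)
    case 0
    show ?case using extend[of 0 0] by simp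
  next
    case (Suc d)
    then obtain p where p: "degree p \<le> d" "\<forall>i\<in>{a..a + int d}. cell_avg E p i = w i" by blast
    show ?case by (rule extend[of p]) (use p in auto)
  qed
qed

lemma poly_with_averages_unique:
  assumes h: "0 < mesh_width E" and "degree p \<le> d" "degree q \<le> d"
    and "\<And>i. i \<in> {a..a + int d} \<Longrightarrow> cell_avg E p i = cell_avg E q i"
  shows "p = q"
proof -
  have "p - q = 0"
    by (rule poly_zero_if_averages_zero[OF h, of _ d a])
      (use assms in \<open>auto simp: cell_avg_diff degree_diff_le\<close>)
  then show ?thesis by simp
qed

lemma stencil_poly_properties:
  assumes h: "0 < mesh_width E"
  shows "degree (stencil_poly E w d {a..a + int d}) \<le> d"
    and "i \<in> {a..a + int d} \<Longrightarrow> cell_avg E (stencil_poly E w d {a..a + int d}) i = w i"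
proof -
  let ?P = "\<lambda>p. degree p \<le> d \<and> (\<forall>i\<in>{a..a + int d}. cell_avg E p i = w i)"
  have "\<exists>!p. ?P p"
    using poly_with_averages_exists[OF h, of d a w] poly_with_averages_unique[OF h, of _ d _ a]
    by (metis (no_types, lifting))
  from theI'[OF this] show "degree (stencil_poly E w d {a..a + int d}) \<le> d"
    and "i \<in> {a..a + int d} \<Longrightarrow> cell_avg E (stencil_poly E w d {a..a + int d}) i = w i"
    by (auto simp: stencil_poly_def)
qed

section \<open>The WENO reconstruction\<close>

lemma weno_poly_stencil:
  "weno_poly E w j k =
     (if k = 0 then stencil_poly E w 4 {j - 2..j - 2 + int 4}
      else stencil_poly E w 2 {j - 3 + int k..j - 3 + int k + int 2})"
proof -
  have "j + 2 = j - 2 + int 4" "j - 1 + int k = j - 3 + int k + int 2" by simp_all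
  then show ?thesis by (simp only: weno_poly_def)
qed

lemma cell_avg_weno_poly:
  assumes "0 < mesh_width E" "k \<le> 3"
  shows "cell_avg E (weno_poly E w j k) j = w j"
  using assms(2) unfolding weno_poly_stencil
  by (cases "k = 0") (simp_all add: stencil_poly_properties(2)[OF assms(1)] del: of_nat_numeral)

lemma weno_alpha_pos: "0 < lin_weight E k \<Longrightarrow> 0 < weno_alpha E w j k"
  unfolding weno_alpha_def by (intro mult_pos_pos add_pos_nonneg) auto

lemma weno_omega_sum:
  assumes "\<And>k. k \<in> {0..3} \<Longrightarrow> 0 < lin_weight E k"
  shows "(\<Sum>k=0..3. weno_omega E w j k) = 1"
proof -
  have "0 < (\<Sum>l=0..3. weno_alpha E w j l)"
    by (rule sum_pos) (auto intro!: weno_alpha_pos assms)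
  then show ?thesis by (simp add: weno_omega_def flip: sum_divide_distrib)
qed

text \<open>
  Each candidate polynomial has the average \<open>w j\<close> on its own cell, and the coefficients in the
  combination of candidates add up to 1 for all values of the nonlinear weights.
\<close>

lemma cell_avg_weno_rec:
  assumes h: "0 < mesh_width E"
    and pos: "\<And>k. k \<in> {0..3} \<Longrightarrow> 0 < lin_weight E k"
    and one: "(\<Sum>k=0..3. lin_weight E k) = 1"
  shows "cell_avg E (weno_rec E w j) j = w j"
proof -
  let ?g = "lin_weight E" and ?o = "weno_omega E w j"
  have avg: "cell_avg E (weno_poly E w j k) j = w j" if "k \<le> 3" for k
    by (rule cell_avg_weno_poly[OF h that])
  have split: "(\<Sum>k=1..3. f k) = (\<Sum>k=0..3. f k) - f 0" for f :: "nat \<Rightarrow> real"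
    by (simp add: sum.atLeast_Suc_atMost[of 0 3])
  have "cell_avg E (weno_rec E w j) j =
      ?o 0 / ?g 0 * (w j - (\<Sum>k=1..3. ?g k * w j)) + (\<Sum>k=1..3. ?o k * w j)"
    by (simp add: weno_rec_def cell_avg_add cell_avg_smult cell_avg_diff cell_avg_sum avg)
  also have "\<dots> = ?o 0 / ?g 0 * (w j - (1 - ?g 0) * w j) + (1 - ?o 0) * w j"
    using split[of ?g] split[of ?o] weno_omega_sum[OF pos] one
    by (simp add: sum_distrib_right[symmetric])
  also have "\<dots> = w j"
    using pos[of 0] by (simp add: field_simps)
  finally show ?thesis .
qed

definition translate_poly :: "real \<Rightarrow> real poly \<Rightarrow> real poly" where
  "translate_poly c p = pcompose p [:- c, 1:]"

lemma poly_translate_poly [simp]: "poly (translate_poly c p) x = poly p (x - c)"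
  by (simp add: translate_poly_def poly_pcompose)

lemma degree_translate_poly [simp]: "degree (translate_poly c p) = degree p"
  by (simp add: translate_poly_def degree_pcompose)

lemma translate_poly_eqI:
  fixes p q :: "real poly"
  assumes "\<And>x. poly p x = poly q (x - c)"
  shows "p = translate_poly c q"
  by (rule poly_ext) (simp add: assms)

lemma pderiv_translate_poly: "pderiv (translate_poly c p) = translate_poly c (pderiv p)"
proof (induction p)
  case (pCons a p)
  then show ?case
    by (simp add: translate_poly_def pcompose_pCons pcompose_add pderiv_add pderiv_diff
        pderiv_smult pderiv_mult pderiv_pCons)
qed (simp add: translate_poly_def)

lemma higher_pderiv_translate_poly:
  "(pderiv ^^ l) (translate_poly c p) = translate_poly c ((pderiv ^^ l) p)"
  by (induction l) (simp_all add: pderiv_translate_poly)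

lemma node_shift: "node E (j + int m) = node E j + real m * mesh_width E"
  by (simp add: node_def algebra_simps)

lemma integral_cell_shift:
  "integral (cell E (j + int m)) (\<lambda>x. f (x - real m * mesh_width E)) = integral (cell E j) f"
proof -
  have "cell E (j + int m) =
      {node E (j - 1) + real m * mesh_width E..node E j + real m * mesh_width E}"
    using node_shift[of E "j - 1" m] node_shift[of E j m] by (simp add: cell_def algebra_simps)
  then show ?thesis
    using integral_shift_Icc_real[of "node E (j - 1)" "node E j" "\<lambda>x. f (x - real m * mesh_width E)"
        "real m * mesh_width E"]
    by (simp only: cell_def o_def add_diff_cancel_left')
qed

lemma cell_avg_translate_poly:
  "cell_avg E (translate_poly (real m * mesh_width E) p) (j + int m) = cell_avg E p j"
proof -
  have "poly (translate_poly (real m * mesh_width E) p) = (\<lambda>x. poly p (x - real m * mesh_width E))"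
    by (simp add: fun_eq_iff)
  then show ?thesis by (simp add: cell_avg_def integral_cell_shift)
qed

lemma stencil_poly_shift:
  assumes h: "0 < mesh_width E" and w: "periodic m w"
  shows "stencil_poly E w d {a + int m..a + int m + int d} =
    translate_poly (real m * mesh_width E) (stencil_poly E w d {a..a + int d})"
proof (rule poly_with_averages_unique[OF h, of _ d _ "a + int m"])
  fix i assume i: "i \<in> {a + int m..a + int m + int d}"
  then have "i - int m \<in> {a..a + int d}" by auto
  then have "cell_avg E (translate_poly (real m * mesh_width E) (stencil_poly E w d {a..a + int d})) i
      = w (i - int m)"
    using cell_avg_translate_poly[of E m _ "i - int m"] stencil_poly_properties(2)[OF h] by simp
  also have "\<dots> = w i" using periodic_shift[OF w, of "i - int m"] by simp
  finally show "cell_avg E (stencil_poly E w d {a + int m..a + int m + int d}) i =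
      cell_avg E (translate_poly (real m * mesh_width E) (stencil_poly E w d {a..a + int d})) i"
    using stencil_poly_properties(2)[OF h i] by simp
qed (simp_all add: stencil_poly_properties(1)[OF h])

lemma weno_poly_shift:
  assumes "0 < mesh_width E" "periodic m w"
  shows "weno_poly E w (j + int m) k = translate_poly (real m * mesh_width E) (weno_poly E w j k)"
  using stencil_poly_shift[OF assms, of 4 "j - 2"] stencil_poly_shift[OF assms, of 2 "j - 3 + int k"]
  by (simp add: weno_poly_stencil algebra_simps)

lemma smoothness_shift:
  assumes "0 < mesh_width E" "periodic m w"
  shows "smoothness E w (j + int m) k = smoothness E w j k"
  unfolding smoothness_def weno_poly_shift[OF assms] higher_pderiv_translate_poly
  using integral_cell_shift[of E j m
      "\<lambda>x. (poly ((pderiv ^^ l) (weno_poly E w j k)) x)\<^sup>2" for l]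
  by simp

lemma weno_omega_shift:
  assumes "0 < mesh_width E" "periodic m w"
  shows "weno_omega E w (j + int m) k = weno_omega E w j k"
  by (simp add: weno_omega_def weno_alpha_def weno_theta_def smoothness_shift[OF assms])

text \<open>
  Stencil polynomials are determined by their averages and therefore move along with the data. The
  smoothness indicators are integrals of their derivatives over the moved cell, so that the
  nonlinear weights do not change.
\<close>

lemma weno_rec_shift:
  assumes "0 < mesh_width E" "periodic m w"
  shows "weno_rec E w (j + int m) = translate_poly (real m * mesh_width E) (weno_rec E w j)"
  by (rule translate_poly_eqI)
    (simp add: weno_rec_def weno_omega_shift[OF assms] weno_poly_shift[OF assms] poly_sum)

section \<open>The cumulative mass of the reconstruction\<close>

text \<open>
  The mass of the piecewise polynomial reconstruction to the left of \<open>x\<close>, measured from the left end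
  of the interval and continued to all real \<open>x\<close>: whole cells contribute their averages, and the
  cell of \<open>x\<close> contributes the integral of its reconstruction polynomial.
\<close>

definition cumulative_mass :: "el_scheme \<Rightarrow> (int \<Rightarrow> real) \<Rightarrow> real \<Rightarrow> real" where
  "cumulative_mass E w x =
     mesh_width E * discrete_primitive w (cell_index E x - 1)
     + integral {node E (cell_index E x - 1)..x} (poly (weno_rec E w (cell_index E x)))"

lemma cell_index_bounds:
  assumes "0 < mesh_width E"
  shows "node E (cell_index E x - 1) \<le> x" and "x \<le> node E (cell_index E x)"
proof -
  have "of_int \<lfloor>(x - left_end E) / mesh_width E\<rfloor> * mesh_width E \<le> x - left_end E"
    using of_int_floor_le pos_le_divide_eq[OF assms] by blast
  moreover have "x - left_end E \<le> (of_int \<lfloor>(x - left_end E) / mesh_width E\<rfloor> + 1) * mesh_width E"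
    using real_of_int_floor_add_one_ge pos_divide_le_eq[OF assms] by blast
  ultimately show "node E (cell_index E x - 1) \<le> x" "x \<le> node E (cell_index E x)"
    by (simp_all add: node_def cell_index_def algebra_simps)
qed

lemma cell_index_mono: "0 < mesh_width E \<Longrightarrow> x \<le> y \<Longrightarrow> cell_index E x \<le> cell_index E y"
  by (simp add: cell_index_def floor_mono divide_right_mono)

lemma cell_index_shift:
  assumes "0 < mesh_width E"
  shows "cell_index E (x + real m * mesh_width E) = cell_index E x + int m"
proof -
  have "(x + real m * mesh_width E - left_end E) / mesh_width E =
      (x - left_end E) / mesh_width E + of_int (int m)"
    using assms by (simp add: field_simps)
  then show ?thesis by (simp only: cell_index_def floor_add_int[symmetric])
qed

text \<open>
  The integral over a traceback cell is an increment of one function of its end points. The full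
  cells between them and the two partial cells fit together because the reconstruction on the
  uniform cell containing \<open>y (j - 1)\<close> has the correct average: its integral to the right of
  \<open>y (j - 1)\<close> is the mass of the whole cell minus the integral to the left.
\<close>

lemma cell_integral_eq_cumulative_mass:
  assumes h: "0 < mesh_width E"
    and pos: "\<And>k. k \<in> {0..3} \<Longrightarrow> 0 < lin_weight E k"
    and one: "(\<Sum>k=0..3. lin_weight E k) = 1"
    and y: "y (j - 1) \<le> y j"
  shows "cell_integral E w y j = cumulative_mass E w (y j) - cumulative_mass E w (y (j - 1))"
proof -
  define l r where "l = cell_index E (y (j - 1))" and "r = cell_index E (y j)"
  note bounds = cell_index_bounds[OF h, of "y (j - 1)", folded l_def]
    cell_index_bounds[OF h, of "y j", folded r_def]
  have "l \<le> r" unfolding l_def r_def by (rule cell_index_mono[OF h y])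
  let ?R = "\<lambda>i. poly (weno_rec E w i)"
  have combine: "integral {a..c} (?R i) = integral {a..b} (?R i) + integral {b..c} (?R i)"
    if "a \<le> b" "b \<le> c" for a b c i
    using Henstock_Kurzweil_Integration.integral_combine[OF that integrable_poly] by simp
  show ?thesis
  proof (cases "l = r")
    case True
    have "cell_integral E w y j = integral {y (j - 1)..y j} (?R l)"
      using True by (simp add: cell_integral_def Let_def flip: l_def r_def)
    moreover have "integral {node E (l - 1)..y j} (?R l) =
        integral {node E (l - 1)..y (j - 1)} (?R l) + integral {y (j - 1)..y j} (?R l)"
      by (rule combine) (use bounds y in auto)
    ultimately show ?thesis
      using True by (simp add: cumulative_mass_def flip: l_def r_def)
  next
    case False
    then have "l < r" using \<open>l \<le> r\<close> by simp
    then have nodes: "node E l \<le> node E (r - 1)" using node_le[OF h] by simp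
    have left: "{y (j - 1)..y j} \<inter> cell E l = {y (j - 1)..node E l}"
      and right: "{y (j - 1)..y j} \<inter> cell E r = {node E (r - 1)..y j}"
      using bounds nodes by (auto simp: cell_def)
    have "integral (cell E l) (?R l) = mesh_width E * w l"
      using cell_avg_weno_rec[OF h pos one, of w l] h by (simp add: cell_avg_def field_simps)
    moreover have "integral (cell E l) (?R l) =
        integral {node E (l - 1)..y (j - 1)} (?R l) + integral {y (j - 1)..node E l} (?R l)"
      unfolding cell_def by (rule combine) (use bounds in auto)
    moreover have "mesh_width E * (\<Sum>i=l+1..r-1. w i) =
        mesh_width E * discrete_primitive w (r - 1) - mesh_width E * discrete_primitive w l"
      using discrete_primitive_sum[of l "r - 1" w] \<open>l < r\<close> by (simp add: right_diff_distrib)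
    moreover have "mesh_width E * discrete_primitive w l =
        mesh_width E * discrete_primitive w (l - 1) + mesh_width E * w l"
      using discrete_primitive_diff[of w l] by (simp flip: distrib_left)
    moreover have "cell_integral E w y j = integral {y (j - 1)..node E l} (?R l)
        + mesh_width E * (\<Sum>i=l+1..r-1. w i) + integral {node E (r - 1)..y j} (?R r)"
      using \<open>l < r\<close> left right by (simp add: cell_integral_def Let_def flip: l_def r_def)
    ultimately show ?thesis
      by (simp add: cumulative_mass_def flip: l_def r_def)
  qed
qed

lemma cumulative_mass_shift:
  assumes h: "0 < mesh_width E" and w: "periodic m w"
  shows "cumulative_mass E w (x + real m * mesh_width E) =
    cumulative_mass E w x + mesh_width E * (\<Sum>i=1..int m. w i)"
proof -
  let ?c = "real m * mesh_width E" and ?l = "cell_index E x"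
  have "node E (?l + int m - 1) = node E (?l - 1) + ?c"
    using node_shift[of E "?l - 1" m] by (simp add: algebra_simps)
  then have "integral {node E (?l + int m - 1)..x + ?c} (poly (weno_rec E w (?l + int m))) =
      integral {node E (?l - 1)..x} (poly (weno_rec E w ?l))"
    using integral_shift_Icc_real[of "node E (?l - 1)" x "poly (weno_rec E w (?l + int m))" ?c]
    by (simp add: weno_rec_shift[OF h w] o_def)
  moreover have "discrete_primitive w (?l + int m - 1) =
      discrete_primitive w (?l - 1) + (\<Sum>i=1..int m. w i)"
    using discrete_primitive_shift[OF w, of "?l - 1"] by (simp add: algebra_simps)
  ultimately show ?thesis
    by (simp add: cumulative_mass_def cell_index_shift[OF h] distrib_left)
qed

section \<open>Conservation for the terms of the scheme\<close>

lemma traceback_shift: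
  assumes "periodic N u"
  shows "traceback E u \<tau> t (j + int N) = traceback E u \<tau> t j + real N * mesh_width E"
proof -
  have "char_speed E u (j + int N) = char_speed E u j"
    using periodic_shift[OF assms, of j] periodic_shift_neighbour(1)[OF assms, of j 1]
    by (simp add: char_speed_def)
  then show ?thesis by (simp add: traceback_def node_shift)
qed

text \<open>
  Conservation depends on a traceback grid through two properties only: its order, which the time
  step restriction guarantees, and its compatibility with the period, which \<open>traceback_shift\<close>
  provides.
\<close>

locale reconstruction_grid =
  fixes E :: el_scheme and N :: nat and y :: "int \<Rightarrow> real"
  assumes h: "0 < mesh_width E"
    and pos: "\<And>k. k \<in> {0..3} \<Longrightarrow> 0 < lin_weight E k"
    and one: "(\<Sum>k=0..3. lin_weight E k) = 1"
    and ordered: "genuine_grid y"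
    and grid_shift: "\<And>j. y (j + int N) = y j + real N * mesh_width E"
begin

lemma cell_integral_eq:
  "cell_integral E w y j = cumulative_mass E w (y j) - cumulative_mass E w (y (j - 1))"
  using cell_integral_eq_cumulative_mass[OF h pos one] ordered
  by (simp add: genuine_grid_def less_imp_le)

lemma grid_shift_pred: "y (j + int N - 1) = y (j - 1) + real N * mesh_width E"
  using grid_shift[of "j - 1"] by (simp add: algebra_simps)

lemma sum_cell_integral:
  assumes "periodic N w"
  shows "(\<Sum>j=1..int N. cell_integral E w y j) = mesh_width E * (\<Sum>j=1..int N. w j)"
proof -
  have "(\<Sum>j=1..int N. cell_integral E w y j) =
      cumulative_mass E w (y (int N)) - cumulative_mass E w (y 0)"
    using sum_int_telescope[of "\<lambda>j. cumulative_mass E w (y j)"] by (simp add: cell_integral_eq)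
  also have "y (int N) = y 0 + real N * mesh_width E" using grid_shift[of 0] by simp
  finally show ?thesis by (simp add: cumulative_mass_shift[OF h assms])
qed

lemma periodic_nonuniform_avg:
  assumes "periodic N w"
  shows "periodic N (nonuniform_avg E w y)"
  by (simp add: periodic_def nonuniform_avg_def cell_integral_eq grid_shift grid_shift_pred
      cumulative_mass_shift[OF h assms])

lemma sum_convective:
  assumes w: "periodic N w" and F: "periodic N (num_flux E)"
  shows "(\<Sum>j=1..int N. convective E w y j) = 0"
proof -
  let ?v = "nonuniform_avg E w y"
  note rec_shift = weno_rec_shift[OF h periodic_nonuniform_avg[OF w]]
  have "u_minus E w y (j + int N) = u_minus E w y j" for j
    using rec_shift[of j] by (simp add: u_minus_def node_shift)
  moreover have "u_plus E w y (j + int N) = u_plus E w y j" for j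
    using rec_shift[of "j + 1"] by (simp add: u_plus_def node_shift algebra_simps)
  ultimately have "periodic N (interface_flux E w y)"
    by (simp add: periodic_def interface_flux_def periodic_shift[OF F])
  then show ?thesis
    using sum_flux_difference[of N "interface_flux E w y"]
    by (simp add: convective_def sum_negf del: minus_diff_eq)
qed

lemma sum_diffusive:
  assumes "periodic N w"
  shows "(\<Sum>j=1..int N. diffusive E w y j) = 0"
proof -
  have "periodic N (\<lambda>i. D4 w i / (mesh_width E)\<^sup>2)"
    using periodic_D4[OF assms] by (simp add: periodic_def)
  from sum_cell_integral[OF this] have "(\<Sum>j=1..int N. diffusive E w y j) =
      diffusion E * (mesh_width E * ((\<Sum>j=1..int N. D4 w j) / (mesh_width E)\<^sup>2))"
    by (simp add: diffusive_def sum_divide_distrib flip: sum_distrib_left)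
  then show ?thesis by (simp add: sum_D4[OF assms])
qed

end

theorem proposition1:
  fixes E :: el_scheme
    and s \<sigma> p :: nat
    and D :: "real set"
    and u u_next :: "int \<Rightarrow> real"
    and U :: "nat \<Rightarrow> int \<Rightarrow> real"
  assumes domain: "left_end E < right_end E"
    and cells: "n_cells E \<ge> 5"
    and flux_C1: "flux E C1_differentiable_on UNIV"
    and diffusion: "diffusion E \<ge> 0"
    and time_step: "time_step E > 0"
    and weights_pos: "\<And>k. k \<in> {0..3} \<Longrightarrow> lin_weight E k > 0"
    and weights_sum: "(\<Sum>k=0..3. lin_weight E k) = 1"
    and small_const: "small_const E > 0"
    and imex: "imex_scheme (tableau E) s \<sigma> p"
    and u_periodic: "periodic (n_cells E) u"
    and flux_periodic: "periodic (n_cells E) (num_flux E)"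
    and flux_consistent: "\<And>j v. num_flux E j v v = flux E v - char_speed E u j * v"
    and flux_range: "is_interval D"
    and flux_monotone: "\<And>j. monotone_flux_on D (num_flux E j)"
    and step: "el_rk_fv_step E U u u_next"
    and genuine: "\<And>\<tau> \<kappa>. (\<tau>, \<kappa>) \<in> used_grids E \<Longrightarrow> genuine_grid (stage_grid E U \<tau> \<kappa>)"
    and values_in_range: "\<And>\<tau> \<kappa> j. (\<tau>, \<kappa>) \<in> used_grids E \<Longrightarrow>
          u_minus E (U \<kappa>) (stage_grid E U \<tau> \<kappa>) j \<in> D \<and>
          u_plus E (U \<kappa>) (stage_grid E U \<tau> \<kappa>) j \<in> D"
  shows "mesh_width E * (\<Sum>j=1..int (n_cells E). u_next j)
       = mesh_width E * (\<Sum>j=1..int (n_cells E). u j)"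
proof -
  let ?N = "n_cells E" and ?T = "tableau E"
  have h: "0 < mesh_width E" using domain cells by (simp add: mesh_width_def)
  have stages: "n_impl ?T = s" "n_expl ?T \<le> s + 1"
    using imex by (auto simp: imex_scheme_def)
  have U0: "U 0 = u" and systems: "\<And>\<mu>. \<mu> \<in> {1..s} \<Longrightarrow> stage_system E U \<mu>"
    and update: "\<And>j. u_next j = mass_next E U j / mesh_width E"
    using step stages by (auto simp: el_rk_fv_step_def)
  have U_periodic: "periodic ?N (U \<kappa>)" if "\<kappa> \<le> s" for \<kappa>
  proof (cases "\<kappa> = 0")
    case True
    then show ?thesis using U0 u_periodic by simp
  next
    case False
    then have "stage_system E U \<kappa>" using systems that by simp
    then show ?thesis by (auto simp: stage_system_def periodic_def)
  qed
  have grid: "reconstruction_grid E ?N (stage_grid E U (end_time E) \<kappa>)" if "\<kappa> \<le> s" for \<kappa>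
  proof
    show "genuine_grid (stage_grid E U (end_time E) \<kappa>)"
      using that stages by (intro genuine) (auto simp: used_grids_def)
  qed (use h weights_pos weights_sum U0 in
      \<open>auto simp: stage_grid_def traceback_shift[OF u_periodic]\<close>)
  have impl: "(\<Sum>j=1..int ?N. K_impl E U (end_time E) \<mu> j) = 0" if "\<mu> \<in> {1..n_impl ?T}" for \<mu>
    using reconstruction_grid.sum_diffusive[OF grid U_periodic, of \<mu> \<mu>] that stages
    by (simp add: K_impl_def)
  have expl: "(\<Sum>j=1..int ?N. K_expl E U (end_time E) \<mu> j) = 0" if "\<mu> \<in> {1..n_expl ?T}" for \<mu>
  proof -
    have "\<mu> - 1 \<le> s" using that stages by auto
    from reconstruction_grid.sum_convective[OF grid[OF this] U_periodic[OF this] flux_periodic]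
    show ?thesis by (simp add: K_expl_def)
  qed
  have no_slope_mass: "(\<Sum>j=1..int ?N. time_step E * (\<Sum>\<mu>\<in>A. c \<mu> * K \<mu> j)) = 0"
    if "\<And>\<mu>. \<mu> \<in> A \<Longrightarrow> (\<Sum>j=1..int ?N. K \<mu> j) = 0" for A c and K :: "nat \<Rightarrow> int \<Rightarrow> real"
  proof -
    have "(\<Sum>j=1..int ?N. \<Sum>\<mu>\<in>A. c \<mu> * K \<mu> j) = (\<Sum>\<mu>\<in>A. c \<mu> * (\<Sum>j=1..int ?N. K \<mu> j))"
      by (subst sum.swap) (simp add: sum_distrib_left)
    then show ?thesis using that by (simp flip: sum_distrib_left)
  qed
  have "mesh_width E * (\<Sum>j=1..int ?N. u_next j) = (\<Sum>j=1..int ?N. mass_next E U j)"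
    using h by (simp add: update flip: sum_divide_distrib)
  also have "\<dots> = (\<Sum>j=1..int ?N. mass_n E U (end_time E) j)"
    by (simp only: mass_next_def sum.distrib no_slope_mass impl expl add_0_right)
  also have "\<dots> = mesh_width E * (\<Sum>j=1..int ?N. u j)"
    using reconstruction_grid.sum_cell_integral[OF grid[of 0] u_periodic] U0
    by (simp add: mass_n_def)
  finally show ?thesis .
qed

end
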